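(* The generating power series $\Phi(\mathbf{x},\mathbf{y})=\sum_{\mathbf{v}}F_{\mathbf{v}}(t)\cdot\mathbf{v}\in\mathbb{Z}[t]\langle\langle\mathbf{x},\mathbf{y}\rangle\rangle$, where the sum is over all $\mathbf{x}\mathbf{y}$-words $\mathbf{v}$ (including the empty word), is given by $$\Phi(\mathbf{x},\mathbf{y})=\left(1+\frac{t+1}{1-(t+1)\cdot\left((1-\mathbf{y})^{-1}\cdot\mathbf{x}+(1-\mathbf{x})^{-1}\cdot\mathbf{y}\right)}\right)\cdot\frac{1}{1-\mathbf{x}-\mathbf{y}}.$$
   Context: $\mathbb{Z}[t]\langle\langle\mathbf{x},\mathbf{y}\rangle\rangle$ is the ring of formal power series in two non-commuting variables $\mathbf{x},\mathbf{y}$ with coefficients in $\mathbb{Z}[t]$ ($t$ commutes with $\mathbf{x}$ and $\mathbf{y}$). An $\mathbf{x}\mathbf{y}$-word is a finite (possibly empty) word in the letters $\mathbf{x},\mathbf{y}$, identified with a non-commutative monomial; the empty word is $1$. For a series $g$ with zero constant term, $\frac{1}{1-g}=(1-g)^{-1}=\sum_{k\ge 0}g^k$, and $\frac{t+1}{1-g}=(t+1)(1-g)^{-1}$. Descent polytope: for an $\mathbf{x}\mathbf{y}$-word $\mathbf{v}=\mathbf{v}_1\cdots\mathbf{v}_{n-1}$ of length $n-1$ ($n\ge 1$), $\mathrm{DP}_{\mathbf{v}}\subset\mathbb{R}^n$ is the set of points $(x_1,\dots,x_n)$ with $0\le x_i\le 1$ for all $i$, and, for $1\le i\le n-1$, $x_i\le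 x_{i+1}$ if $\mathbf{v}_i=\mathbf{x}$ and $x_i\ge x_{i+1}$ if $\mathbf{v}_i=\mathbf{y}$. $f$-polynomial: $F_{\mathbf{v}}(t)=\sum_{\mathcal F} t^{\dim\mathcal F}$, the sum being over all nonempty faces $\mathcal F$ of $\mathrm{DP}_{\mathbf{v}}$, including $\mathrm{DP}_{\mathbf{v}}$ itself. *)

theory Defs
  imports
    "HOL-Analysis.Analysis"
    "HOL-Analysis.Finite_Function_Topology"
begin

section \<open>Formal power series in non-commuting variables\<close>

typedef ('a, 'r) ncfps = "UNIV :: ('a list \<Rightarrow> 'r) set"
  morphisms coeff_word Abs_ncfps ..

setup_lifting type_definition_ncfps

lemma ncfps_eqI: "(\<And>w. coeff_word f w = coeff_word g w) \<Longrightarrow> f = g"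
  by transfer auto

instantiation ncfps :: (type, ring_1) ring_1
begin

lift_definition zero_ncfps :: "('a, 'b) ncfps" is "\<lambda>_. 0" .
lift_definition one_ncfps :: "('a, 'b) ncfps" is "\<lambda>w. if w = [] then 1 else 0" .
lift_definition plus_ncfps :: "('a, 'b) ncfps \<Rightarrow> ('a, 'b) ncfps \<Rightarrow> ('a, 'b) ncfps"
  is "\<lambda>f g w. f w + g w" .
lift_definition minus_ncfps :: "('a, 'b) ncfps \<Rightarrow> ('a, 'b) ncfps \<Rightarrow> ('a, 'b) ncfps"
  is "\<lambda>f g w. f w - g w" .
lift_definition uminus_ncfps :: "('a, 'b) ncfps \<Rightarrow> ('a, 'b) ncfps"
  is "\<lambda>f w. - f w" .

text \<open>Every factorisation \<open>w = u @ v\<close> is \<open>(take i w, drop i w)\<close> for exactly one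
  \<open>i \<le> length w\<close>, so this is the convolution over concatenation of words.\<close>
lift_definition times_ncfps :: "('a, 'b) ncfps \<Rightarrow> ('a, 'b) ncfps \<Rightarrow> ('a, 'b) ncfps"
  is "\<lambda>f g w. \<Sum>i=0..length w. f (take i w) * g (drop i w)" .

instance
proof
  fix f g h :: "('a, 'b) ncfps"
  show "f * g * h = f * (g * h)"
  proof (transfer, rule ext)
    fix f g h :: "'a list \<Rightarrow> 'b" and w :: "'a list"
    let ?n = "length w"
    let ?F = "\<lambda>i j k. f (take i w) * g (take j (drop i w)) * h (drop (?n - k) w)"
    have "(\<Sum>j=0..?n. (\<Sum>i=0..length (take j w).
              f (take i (take j w)) * g (drop i (take j w))) * h (drop j w))
        = (\<Sum>j=0..?n. \<Sum>i=0..j. ?F i (j - i) (?n - j))"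
      by (intro sum.cong refl) (auto intro!: sum.cong simp: sum_distrib_right min_def drop_take)
    also have "\<dots> = (\<Sum>j=0..?n. \<Sum>i=0..?n - j. ?F j i (?n - j - i))"
      by (rule fps_mult_assoc_lemma)
    also have "\<dots> = (\<Sum>j=0..?n. f (take j w) * (\<Sum>i=0..length (drop j w).
              g (take i (drop j w)) * h (drop i (drop j w))))"
    proof (intro sum.cong refl)
      fix j assume "j \<in> {0..?n}"
      then have "?n - (?n - j - i) = i + j" if "i \<le> ?n - j" for i
        using that by auto
      then show "(\<Sum>i=0..?n - j. ?F j i (?n - j - i)) = f (take j w) *
          (\<Sum>i=0..length (drop j w). g (take i (drop j w)) * h (drop i (drop j w)))"
        unfolding sum_distrib_left by (intro sum.cong) (simp_all add: mult.assoc)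
    qed
    finally show "(\<Sum>j=0..?n. (\<Sum>i=0..length (take j w).
              f (take i (take j w)) * g (drop i (take j w))) * h (drop j w))
        = (\<Sum>j=0..?n. f (take j w) * (\<Sum>i=0..length (drop j w).
              g (take i (drop j w)) * h (drop i (drop j w))))" .
  qed
  show "1 * f = f"
  proof (transfer, rule ext)
    fix f :: "'a list \<Rightarrow> 'b" and w :: "'a list"
    have "(\<Sum>i=0..length w. (if take i w = [] then 1 else 0) * f (drop i w))
        = (\<Sum>i=0..length w. if i = 0 then f w else 0)"
      by (rule sum.cong) auto
    then show "(\<Sum>i=0..length w. (if take i w = [] then 1 else 0) * f (drop i w)) = f w"
      by simp
  qed
  show "f * 1 = f"
  proof (transfer, rule ext)
    fix f :: "'a list \<Rightarrow> 'b" and w :: "'a list"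
    have "(\<Sum>i=0..length w. f (take i w) * (if drop i w = [] then 1 else 0))
        = (\<Sum>i=0..length w. if i = length w then f w else 0)"
      by (rule sum.cong) auto
    then show "(\<Sum>i=0..length w. f (take i w) * (if drop i w = [] then 1 else 0)) = f w"
      by simp
  qed
  show "f + g + h = f + (g + h)" by transfer (simp add: add.assoc)
  show "f + g = g + f" by transfer (simp add: add.commute)
  show "0 + f = f" by transfer simp
  show "- f + f = 0" by transfer simp
  show "f - g = f + - g" by transfer simp
  show "(f + g) * h = f * h + g * h" by transfer (simp add: distrib_right sum.distrib)
  show "f * (g + h) = f * g + f * h" by transfer (simp add: distrib_left sum.distrib)
  show "(0 :: ('a, 'b) ncfps) \<noteq> 1" by transfer (auto dest: fun_cong[of _ _ "[]"])
qed

end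

text \<open>The quotient \<open>f / g\<close> is the right quotient \<open>f * inverse g\<close>.\<close>
instantiation ncfps :: (type, ring_1) inverse
begin

definition inverse_ncfps :: "('a, 'b) ncfps \<Rightarrow> ('a, 'b) ncfps" where
  "inverse f = (if \<exists>h. f * h = 1 \<and> h * f = 1 then THE h. f * h = 1 \<and> h * f = 1 else 0)"
  for f :: "('a, 'b) ncfps"

definition divide_ncfps :: "('a, 'b) ncfps \<Rightarrow> ('a, 'b) ncfps \<Rightarrow> ('a, 'b) ncfps" where
  "f div g = f * inverse g" for f g :: "('a, 'b) ncfps"

instance ..

end

lemma inverse_ncfps_eqI:
  fixes f h :: "('a, 'b::ring_1) ncfps"
  assumes "f * h = 1" "h * f = 1"
  shows "inverse f = h"
proof -
  have "h' = h" if "f * h' = 1" for h'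
  proof -
    have "h' = (h * f) * h'" by (simp add: assms(2))
    also have "\<dots> = h" by (simp add: mult.assoc that)
    finally show ?thesis .
  qed
  then have "(THE h. f * h = 1 \<and> h * f = 1) = h"
    using assms by (intro the_equality) blast+
  moreover have "\<exists>h. f * h = 1 \<and> h * f = 1"
    using assms by blast
  ultimately show ?thesis
    by (simp only: inverse_ncfps_def if_True simp_thms)
qed

definition nc_const :: "'r::ring_1 \<Rightarrow> ('a, 'r) ncfps" where
  "nc_const c = Abs_ncfps (\<lambda>w. if w = [] then c else 0)"

definition nc_var :: "'a \<Rightarrow> ('a, 'r::ring_1) ncfps" where
  "nc_var a = Abs_ncfps (\<lambda>w. if w = [a] then 1 else 0)"

text \<open>The geometric series \<open>\<Sum>k. g ^ k\<close> of a series \<open>g\<close> without constant term: powers beyond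
  \<open>length w\<close> do not contribute to the coefficient of \<open>w\<close>.\<close>
definition nc_geometric :: "('a, 'r::ring_1) ncfps \<Rightarrow> ('a, 'r) ncfps" where
  "nc_geometric g = Abs_ncfps (\<lambda>w. \<Sum>k\<le>length w. coeff_word (g ^ k) w)"

lemma coeff_word_power_eq_0:
  assumes "coeff_word g [] = 0" "length w < k"
  shows "coeff_word (g ^ k) w = 0"
  using assms(2)
proof (induction k arbitrary: w)
  case (Suc k)
  have "coeff_word g (take i w) * coeff_word (g ^ k) (drop i w) = 0" if "i \<le> length w" for i
    using assms(1) Suc.IH[of "drop i w"] Suc.prems that by (cases "i = 0") auto
  then show ?case
    by (auto simp: times_ncfps.rep_eq intro!: sum.neutral)
qed auto

lemma coeff_word_sum: "coeff_word (sum F A) w = (\<Sum>k\<in>A. coeff_word (F k) w)"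
  by (induction A rule: infinite_finite_induct) (auto simp: zero_ncfps.rep_eq plus_ncfps.rep_eq)

lemma coeff_word_geometric:
  assumes "coeff_word g [] = 0" "length w \<le> N"
  shows "coeff_word (nc_geometric g) w = coeff_word (\<Sum>k\<le>N. g ^ k) w"
proof -
  have "(\<Sum>k\<le>length w. coeff_word (g ^ k) w) = (\<Sum>k\<le>N. coeff_word (g ^ k) w)"
    using assms by (intro sum.mono_neutral_left) (auto intro!: coeff_word_power_eq_0)
  then show ?thesis
    by (simp add: nc_geometric_def Abs_ncfps_inverse coeff_word_sum)
qed

lemma inverse_one_minus_eq_geometric:
  assumes "coeff_word g [] = 0"
  shows "inverse (1 - g) = nc_geometric g"
proof (rule inverse_ncfps_eqI)
  have L: "(1 - g) * (\<Sum>k\<le>N. g ^ k) = 1 - g ^ Suc N" for N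
  proof (induction N)
    case (Suc N)
    have "(1 - g) * (\<Sum>k\<le>Suc N. g ^ k) = (1 - g) * (\<Sum>k\<le>N. g ^ k) + (1 - g) * g ^ Suc N"
      by (simp add: distrib_left)
    also have "\<dots> = 1 - g ^ Suc (Suc N)"
      unfolding Suc.IH by (simp add: left_diff_distrib)
    finally show ?case .
  qed simp
  have R: "(\<Sum>k\<le>N. g ^ k) * (1 - g) = 1 - g ^ Suc N" for N
  proof (induction N)
    case (Suc N)
    have "(\<Sum>k\<le>Suc N. g ^ k) * (1 - g) = (\<Sum>k\<le>N. g ^ k) * (1 - g) + g ^ Suc N * (1 - g)"
      by (simp add: distrib_right)
    also have "\<dots> = 1 - g ^ Suc (Suc N)"
      unfolding Suc.IH by (simp add: right_diff_distrib power_Suc2 del: power_Suc)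
    finally show ?case .
  qed simp
  show "(1 - g) * nc_geometric g = 1"
  proof (rule ncfps_eqI)
    fix w
    have "coeff_word ((1 - g) * nc_geometric g) w
        = coeff_word ((1 - g) * (\<Sum>k\<le>length w. g ^ k)) w"
      unfolding times_ncfps.rep_eq
      by (intro sum.cong refl) (simp add: coeff_word_geometric[OF assms, of _ "length w"])
    also have "\<dots> = coeff_word 1 w"
      unfolding L minus_ncfps.rep_eq using coeff_word_power_eq_0[OF assms, of w "Suc (length w)"]
      by simp
    finally show "coeff_word ((1 - g) * nc_geometric g) w = coeff_word 1 w" .
  qed
  show "nc_geometric g * (1 - g) = 1"
  proof (rule ncfps_eqI)
    fix w
    have "coeff_word (nc_geometric g * (1 - g)) w
        = coeff_word ((\<Sum>k\<le>length w. g ^ k) * (1 - g)) w"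
      unfolding times_ncfps.rep_eq
      by (intro sum.cong refl) (simp add: coeff_word_geometric[OF assms, of _ "length w"])
    also have "\<dots> = coeff_word 1 w"
      unfolding R minus_ncfps.rep_eq using coeff_word_power_eq_0[OF assms, of w "Suc (length w)"]
      by simp
    finally show "coeff_word (nc_geometric g * (1 - g)) w = coeff_word 1 w" .
  qed
qed


section \<open>Descent polytopes and their f-polynomials\<close>

datatype letter = X | Y

text \<open>Since the dimension varies with the word, \<open>\<real>\<^sup>n\<close> is taken to be the subspace
  \<open>{p. keys p \<subseteq> {..<n}}\<close> of the real vector space of finitely supported sequences.
  Coordinates are numbered from 0, and \<open>n = Suc (length v)\<close>.\<close>
definition descent_polytope :: "letter list \<Rightarrow> (nat \<Rightarrow>\<^sub>0 real) set" where
  "descent_polytope v =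
     {p. Poly_Mapping.keys p \<subseteq> {..<Suc (length v)} \<and>
         (\<forall>i < Suc (length v). 0 \<le> Poly_Mapping.lookup p i \<and> Poly_Mapping.lookup p i \<le> 1) \<and>
         (\<forall>i < length v. case v ! i of
              X \<Rightarrow> Poly_Mapping.lookup p i \<le> Poly_Mapping.lookup p (Suc i)
            | Y \<Rightarrow> Poly_Mapping.lookup p i \<ge> Poly_Mapping.lookup p (Suc i))}"

text \<open>The library's \<^const>\<open>aff_dim\<close> is restricted to Euclidean spaces. For nonempty sets,
  the dimension of the direction space of the affine hull makes sense in any real vector space
  and agrees with it there.\<close>
definition affine_dimension :: "'a::real_vector set \<Rightarrow> nat" where
  "affine_dimension S = dim {x - y |x y. x \<in> S \<and> y \<in> S}"

lemma affine_dimension_eq_aff_dim: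
  fixes S :: "'a::euclidean_space set"
  assumes "S \<noteq> {}"
  shows "int (affine_dimension S) = aff_dim S"
proof -
  obtain a where a: "a \<in> S" using assms by auto
  have "span {x - y |x y. x \<in> S \<and> y \<in> S} = span ((\<lambda>x. x - a) ` S)"
  proof (rule span_eq[THEN iffD2], intro conjI subsetI)
    fix z assume "z \<in> {x - y |x y. x \<in> S \<and> y \<in> S}"
    then obtain x y where xy: "x \<in> S" "y \<in> S" and z: "z = (x - a) - (y - a)" by auto
    show "z \<in> span ((\<lambda>x. x - a) ` S)"
      unfolding z using xy by (intro span_diff span_base imageI)
  next
    fix z assume "z \<in> (\<lambda>x. x - a) ` S"
    then show "z \<in> span {x - y |x y. x \<in> S \<and> y \<in> S}"
      using a by (intro span_base) auto
  qed
  then have "affine_dimension S = dim ((\<lambda>x. x - a) ` S)"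
    unfolding affine_dimension_def by (rule span_eq_dim)
  then show ?thesis
    using aff_dim_eq_dim_subtract[OF hull_inc[OF a]] by simp
qed

definition f_polynomial :: "letter list \<Rightarrow> int poly" where
  "f_polynomial v =
     (\<Sum>F \<in> {F. F face_of descent_polytope v \<and> F \<noteq> {}}. monom 1 (affine_dimension F))"

definition Phi :: "(letter, int poly) ncfps" where
  "Phi = Abs_ncfps f_polynomial"

end

theory Submission
  imports Defs
begin

text \<open>A nonempty face of a polyhedron is determined by the set of defining inequalities that are
  equalities at its relative interior points. Hence nonempty faces correspond to the sets of tight
  inequalities that occur at points (\<open>nonempty_faces\<close>, \<open>tight_face_eq_iff\<close>), and the dimension of
  a face is that of the space of solutions of the homogeneous tight equations.

  For a descent polytope the tight inequalities at a point say which coordinates are 0, which are 1,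
  and which neighbouring coordinates agree. Reading the coordinates from left to right, this
  information is a word over four symbols: \<open>Bottom\<close> (the value 0), \<open>Top\<close> (the value 1), and, for a
  value strictly between, \<open>Same\<close> or \<open>New\<close> according to whether it repeats the previous
  coordinate. A face can be moved along each maximal block of equal interior coordinates
  independently, so its dimension is the number of symbols \<open>New\<close>
  (\<open>affine_dimension_tight_face\<close>).

  Which symbols can follow depends only on the last symbol and the next letter, because there is
  always room for a new value strictly between an interior value and 0 or 1 (\<open>next_cells\<close>). So
  the \<open>f\<close>-polynomials are computed by a transfer operator on three states: bottom, interior, top.
  Let \<open>P\<close> and \<open>Q\<close> be the generating series of the faces whose last coordinate is not
  constantly 1, respectively not constantly 0. Appending a letter gives
  (\<open>code_sum_recursion\<close>), with \<open>B = (t + 1) (1 + P x + Q y)\<close>,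
  \<open>P = B + P y\<close>, \<open>Q = B + Q x\<close> and \<open>Phi = 1 + B + Phi (x + y)\<close>.
  The first two equations give \<open>P\<close> and \<open>Q\<close> in terms of \<open>B\<close>, which turns the definition of \<open>B\<close>
  into a linear equation; its solution is the fraction in the theorem, and the last equation
  contributes the factor on the right.\<close>

section \<open>Faces of a polyhedron and sets of tight inequalities\<close>

text \<open>Inequalities \<open>0 \<le> b i + L i p\<close> on a subspace \<open>V\<close>. The ambient space need not be
  finite-dimensional, so that sequences of finite support are covered.\<close>
locale inequality_system =
  fixes V :: "'a::real_vector set" and I :: "'i set"
    and b :: "'i \<Rightarrow> real" and L :: "'i \<Rightarrow> 'a \<Rightarrow> real"
  assumes subspace_V: "subspace V"
    and finite_I: "finite I"
    and linear_L: "\<And>i. i \<in> I \<Longrightarrow> linear (L i)"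
begin

definition feasible :: "'a set" where
  "feasible = {p \<in> V. \<forall>i\<in>I. 0 \<le> b i + L i p}"

definition tight :: "'a \<Rightarrow> 'i set" where
  "tight p = {i \<in> I. b i + L i p = 0}"

definition tight_face :: "'a \<Rightarrow> 'a set" where
  "tight_face p = {q \<in> feasible. tight p \<subseteq> tight q}"

lemma feasibleI: "p \<in> V \<Longrightarrow> (\<And>i. i \<in> I \<Longrightarrow> 0 \<le> b i + L i p) \<Longrightarrow> p \<in> feasible"
  by (simp add: feasible_def)

lemma feasibleD: "p \<in> feasible \<Longrightarrow> i \<in> I \<Longrightarrow> 0 \<le> b i + L i p"
  by (simp add: feasible_def)

lemma affine_value:
  assumes "i \<in> I"
  shows "b i + L i ((1 - u) *\<^sub>R p + u *\<^sub>R q) = (1 - u) * (b i + L i p) + u * (b i + L i q)"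
  by (simp add: linear_add[OF linear_L[OF assms]] linear_scale[OF linear_L[OF assms]])
    (simp add: algebra_simps)

lemma convex_tight_set: "convex {q \<in> feasible. T \<subseteq> tight q}"
proof (rule convexI)
  fix x y and u v :: real
  assume x: "x \<in> {q \<in> feasible. T \<subseteq> tight q}" and y: "y \<in> {q \<in> feasible. T \<subseteq> tight q}"
    and uv: "0 \<le> u" "0 \<le> v" "u + v = 1"
  have u: "u = 1 - v" using uv by simp
  have "u *\<^sub>R x + v *\<^sub>R y \<in> feasible"
  proof (rule feasibleI)
    show "u *\<^sub>R x + v *\<^sub>R y \<in> V"
      using x y subspace_V by (auto simp: feasible_def intro: subspace_add subspace_scale)
    show "0 \<le> b i + L i (u *\<^sub>R x + v *\<^sub>R y)" if "i \<in> I" for i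
      using x y that uv unfolding u affine_value[OF that] by (auto simp: feasible_def)
  qed
  moreover have "T \<subseteq> tight (u *\<^sub>R x + v *\<^sub>R y)"
  proof
    fix i assume "i \<in> T"
    then have "i \<in> I" "b i + L i x = 0" "b i + L i y = 0" using x y by (auto simp: tight_def)
    then show "i \<in> tight (u *\<^sub>R x + v *\<^sub>R y)" unfolding u tight_def by (simp add: affine_value)
  qed
  ultimately show "u *\<^sub>R x + v *\<^sub>R y \<in> {q \<in> feasible. T \<subseteq> tight q}" by simp
qed

text \<open>A positive combination of two nonnegative numbers vanishes only if both do.\<close>
lemma tight_on_segment:
  assumes pq: "p \<in> feasible" "q \<in> feasible" and r: "r \<in> open_segment p q"
  shows "tight r = tight p \<inter> tight q"
proof -
  obtain u where u: "0 < u" "u < 1" and r: "r = (1 - u) *\<^sub>R p + u *\<^sub>R q"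
    using r by (auto simp: in_segment)
  have "b i + L i r = 0 \<longleftrightarrow> b i + L i p = 0 \<and> b i + L i q = 0" if i: "i \<in> I" for i
    using u feasibleD[OF pq(1) i] feasibleD[OF pq(2) i]
    unfolding r affine_value[OF i] by (simp add: add_nonneg_eq_0_iff)
  then show ?thesis by (auto simp: tight_def)
qed

lemma tight_face_face_of: "tight_face p face_of feasible"
  unfolding face_of_def
proof (intro conjI ballI impI)
  show "tight_face p \<subseteq> feasible" by (auto simp: tight_face_def)
  show "convex (tight_face p)" unfolding tight_face_def by (rule convex_tight_set)
next
  fix x y z assume "x \<in> feasible" "y \<in> feasible" "z \<in> tight_face p" "z \<in> open_segment x y"
  then show "x \<in> tight_face p" "y \<in> tight_face p"
    using tight_on_segment[of x y z] by (auto simp: tight_face_def)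
qed

text \<open>The slack inequalities remain valid after a short move in any direction, and the tight
  ones are unaffected by a move along which their linear parts vanish.\<close>
lemma move_in_tight_face:
  assumes p: "p \<in> feasible" and d: "d \<in> V" "\<And>i. i \<in> tight p \<Longrightarrow> L i d = 0"
  obtains e where "e > 0" "p + e *\<^sub>R d \<in> tight_face p"
proof -
  have lin: "b i + L i (p + s *\<^sub>R d) = b i + L i p + s * L i d" if "i \<in> I" for i s
    using linear_L[OF that] by (simp add: linear_add linear_scale)
  have "\<forall>\<^sub>F s in at_right 0. 0 \<le> b i + L i (p + s *\<^sub>R d)" if i: "i \<in> I" for i
  proof (cases "i \<in> tight p")
    case True
    then show ?thesis using d(2)[of i] by (simp add: lin i tight_def)
  next
    case False
    have "((\<lambda>s. b i + L i p + s * L i d) \<longlongrightarrow> b i + L i p + 0 * L i d) (at_right 0)"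
      by (intro tendsto_intros)
    moreover have "0 < b i + L i p"
      using False feasibleD[OF p i] i by (simp add: tight_def)
    ultimately have "\<forall>\<^sub>F s in at_right 0. 0 < b i + L i p + s * L i d"
      by (intro order_tendstoD(1)) auto
    then show ?thesis by eventually_elim (simp add: lin[OF i])
  qed
  then have "\<forall>\<^sub>F s in at_right 0. \<forall>i\<in>I. 0 \<le> b i + L i (p + s *\<^sub>R d)"
    by (simp add: eventually_ball_finite_distrib[OF finite_I])
  moreover have "\<forall>\<^sub>F s in at_right 0. (0::real) < s"
    by (rule eventually_at_right_less)
  ultimately have "\<forall>\<^sub>F s in at_right 0. 0 < s \<and> (\<forall>i\<in>I. 0 \<le> b i + L i (p + s *\<^sub>R d))"
    by eventually_elim simp
  then obtain e where e: "0 < e" "\<forall>i\<in>I. 0 \<le> b i + L i (p + e *\<^sub>R d)"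
    using eventually_happens'[OF trivial_limit_at_right_real] by blast
  have "p + e *\<^sub>R d \<in> feasible"
    using e p d(1) subspace_V by (auto simp: feasible_def intro: subspace_add subspace_scale)
  moreover have "tight p \<subseteq> tight (p + e *\<^sub>R d)"
    using d(2) by (auto simp: tight_def lin)
  ultimately show ?thesis using that e(1) by (auto simp: tight_face_def)
qed

text \<open>The point \<open>p\<close> is a relative interior point of \<open>F\<close>, found as a point with the fewest tight
  inequalities: the midpoint of \<open>p\<close> and another point \<open>q\<close> of \<open>F\<close> has only the common tight
  inequalities, so those of \<open>p\<close> are tight at \<open>q\<close>. Conversely, from a point \<open>q\<close> satisfying
  these equalities the segment to \<open>p\<close> can be prolonged a little beyond \<open>p\<close> inside the polyhedron,
  and the defining property of faces puts \<open>q\<close> into \<open>F\<close>.\<close>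
lemma face_eq_tight_face:
  assumes F: "F face_of feasible" and "F \<noteq> {}"
  obtains p where "p \<in> feasible" "F = tight_face p"
proof -
  have sub: "F \<subseteq> feasible" and conv: "convex F"
    using F by (auto simp: face_of_def)
  obtain p where pF: "p \<in> F" and minp: "\<And>q. q \<in> F \<Longrightarrow> card (tight p) \<le> card (tight q)"
    using \<open>F \<noteq> {}\<close> ex_has_least_nat[of "\<lambda>q. q \<in> F" _ "\<lambda>q. card (tight q)"] by auto
  have p: "p \<in> feasible" using pF sub by blast
  have fin: "finite (tight q)" for q using finite_I by (simp add: tight_def)
  have "tight p \<subseteq> tight q" if q: "q \<in> F" for q
  proof (cases "q = p")
    case False
    define m where "m = midpoint p q"
    have m: "m \<in> open_segment p q" using False by (simp add: m_def)
    then have "m \<in> F"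
      using conv pF q by (auto simp: convex_contains_open_segment)
    have "tight m = tight p \<inter> tight q"
      using tight_on_segment[OF p _ m] q sub by blast
    then have "tight p \<inter> tight q = tight p"
      using minp[OF \<open>m \<in> F\<close>] by (intro card_seteq fin) auto
    then show ?thesis by blast
  qed auto
  then have "F \<subseteq> tight_face p" using sub by (auto simp: tight_face_def)
  moreover have "q \<in> F" if q: "q \<in> tight_face p" for q
  proof (cases "q = p")
    case False
    have qP: "q \<in> feasible" using q by (simp add: tight_face_def)
    have "p - q \<in> V" using p qP subspace_V by (auto simp: feasible_def intro: subspace_diff)
    moreover have "L i (p - q) = 0" if "i \<in> tight p" for i
    proof -
      have "i \<in> tight q" using q that by (auto simp: tight_face_def)
      then show ?thesis using that linear_L[of i] by (auto simp: tight_def linear_diff)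
    qed
    ultimately obtain e where e: "e > 0" and r: "p + e *\<^sub>R (p - q) \<in> tight_face p"
      using move_in_tight_face[OF p, of "p - q"] by blast
    let ?r = "p + e *\<^sub>R (p - q)"
    \<comment> \<open>The weight for which \<open>p\<close> divides the segment from \<open>q\<close> to \<open>p + e (p - q)\<close>.\<close>
    define w where "w = 1 / (1 + e)"
    have w: "0 < w" "w < 1" "w + w * e = 1" using e by (auto simp: w_def field_simps)
    have "(1 - w) *\<^sub>R q + w *\<^sub>R ?r = (1 - (w + w * e)) *\<^sub>R q + (w + w * e) *\<^sub>R p"
      by (simp add: algebra_simps)
    then have "p = (1 - w) *\<^sub>R q + w *\<^sub>R ?r" by (simp add: w(3))
    moreover have "q \<noteq> ?r"
    proof
      assume "q = ?r"
      then have "(1 + e) *\<^sub>R (p - q) = 0" by (simp add: algebra_simps)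
      then show False using e False by simp
    qed
    ultimately have "p \<in> open_segment q ?r"
      using w unfolding in_segment by blast
    moreover have "?r \<in> feasible" using r by (simp add: tight_face_def)
    ultimately show ?thesis using F pF qP unfolding face_of_def by blast
  qed (use pF in simp)
  ultimately have "F = tight_face p" by blast
  then show ?thesis using p that by blast
qed

lemma nonempty_faces: "{F. F face_of feasible \<and> F \<noteq> {}} = tight_face ` feasible"
proof -
  have "p \<in> tight_face p" if "p \<in> feasible" for p using that by (simp add: tight_face_def)
  then show ?thesis using tight_face_face_of face_eq_tight_face by (auto; blast)
qed

lemma tight_face_eq_iff:
  assumes "p \<in> feasible" "q \<in> feasible"
  shows "tight_face p = tight_face q \<longleftrightarrow> tight p = tight q"
  using assms by (auto simp: tight_face_def)

text \<open>Together with \<open>span_directions_tight_face\<close> this identifies the direction space of a face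
  with the solution space of the homogeneous tight equations.\<close>
lemma direction_tight_face:
  assumes p: "p \<in> feasible" and d: "d \<in> {x - y |x y. x \<in> tight_face p \<and> y \<in> tight_face p}"
  shows "d \<in> V" "\<And>i. i \<in> tight p \<Longrightarrow> L i d = 0"
proof -
  obtain x y where xy: "x \<in> tight_face p" "y \<in> tight_face p" and d: "d = x - y"
    using d by blast
  show "d \<in> V"
    using xy subspace_V unfolding d by (auto simp: tight_face_def feasible_def intro: subspace_diff)
  show "L i d = 0" if "i \<in> tight p" for i
  proof -
    have "i \<in> tight x" "i \<in> tight y" using xy that by (auto simp: tight_face_def)
    then show ?thesis unfolding d using linear_L[of i] by (auto simp: tight_def linear_diff)
  qed
qed

lemma span_directions_tight_face:
  assumes p: "p \<in> feasible" and d: "d \<in> V" "\<And>i. i \<in> tight p \<Longrightarrow> L i d = 0"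
  shows "d \<in> span {x - y |x y. x \<in> tight_face p \<and> y \<in> tight_face p}"
proof -
  obtain e where e: "e > 0" "p + e *\<^sub>R d \<in> tight_face p"
    using move_in_tight_face[OF p d] by blast
  have "p \<in> tight_face p" using p by (simp add: tight_face_def)
  then have "e *\<^sub>R d \<in> span {x - y |x y. x \<in> tight_face p \<and> y \<in> tight_face p}"
    using e(2) by (intro span_base CollectI exI[of _ "p + e *\<^sub>R d"] exI[of _ p]) simp
  then have "inverse e *\<^sub>R (e *\<^sub>R d) \<in> span {x - y |x y. x \<in> tight_face p \<and> y \<in> tight_face p}"
    by (rule span_scale)
  then show ?thesis using e by simp
qed

end

text \<open>Linear functionals \<open>\<phi> j\<close> that form a dual family make the vectors \<open>f j\<close> independent;
  the expansion makes them span \<open>D\<close>.\<close>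
lemma dim_eq_card_dual_family:
  fixes D :: "'a::real_vector set"
  assumes fin: "finite J"
    and lin: "\<And>j. j \<in> J \<Longrightarrow> linear (\<phi> j :: 'a \<Rightarrow> real)"
    and dual: "\<And>i j. i \<in> J \<Longrightarrow> j \<in> J \<Longrightarrow> \<phi> i (f j) = (if i = j then 1 else 0)"
    and sub: "f ` J \<subseteq> span D"
    and expand: "\<And>d. d \<in> D \<Longrightarrow> d = (\<Sum>j\<in>J. \<phi> j d *\<^sub>R f j)"
  shows "dim D = card J"
proof -
  have inj: "inj_on f J"
  proof (rule inj_onI)
    fix i j assume "i \<in> J" "j \<in> J" "f i = f j"
    then show "i = j" using dual[of i i] dual[of i j] by (auto split: if_splits)
  qed
  have "independent (f ` J)"
  proof (rule independent_if_scalars_zero)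
    fix u x assume 0: "(\<Sum>x\<in>f ` J. u x *\<^sub>R x) = 0" and "x \<in> f ` J"
    then obtain i where i: "i \<in> J" "x = f i" by blast
    have "0 = \<phi> i (\<Sum>j\<in>J. u (f j) *\<^sub>R f j)"
      using 0 by (simp add: sum.reindex[OF inj] linear_0[OF lin[OF i(1)]])
    also have "\<dots> = (\<Sum>j\<in>J. u (f j) * (if i = j then 1 else 0))"
      by (simp add: linear_sum[OF lin[OF i(1)]] linear_scale[OF lin[OF i(1)]] dual i)
    also have "\<dots> = (\<Sum>j\<in>J. if i = j then u (f j) else 0)" by (intro sum.cong) auto
    also have "\<dots> = u x" using fin i by simp
    finally show "u x = 0" by simp
  qed (use fin in simp)
  moreover have "D \<subseteq> span (f ` J)"
  proof
    fix d assume "d \<in> D"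
    show "d \<in> span (f ` J)"
      by (subst expand[OF \<open>d \<in> D\<close>]) (intro span_sum span_scale span_base imageI)
  qed
  then have "span (f ` J) = span D"
    using sub by (simp add: span_eq)
  ultimately have "dim D = card (f ` J)" by (intro dim_eq_card)
  then show ?thesis by (simp add: card_image[OF inj])
qed

section \<open>The descent polytope\<close>

text \<open>Names for the inequalities defining a descent polytope: \<open>Lower i\<close> and \<open>Upper i\<close> bound the
  coordinate \<open>i\<close> by 0 and 1, and \<open>Step i\<close> compares it with the next one.\<close>
datatype bound = Lower nat | Upper nat | Step nat

fun bound_const :: "bound \<Rightarrow> real" where
  "bound_const (Lower i) = 0"
| "bound_const (Upper i) = 1"
| "bound_const (Step i) = 0"

fun bound_linear :: "letter list \<Rightarrow> bound \<Rightarrow> (nat \<Rightarrow>\<^sub>0 real) \<Rightarrow> real" where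
  "bound_linear v (Lower i) p = Poly_Mapping.lookup p i"
| "bound_linear v (Upper i) p = - Poly_Mapping.lookup p i"
| "bound_linear v (Step i) p = (case v ! i of
      X \<Rightarrow> Poly_Mapping.lookup p (Suc i) - Poly_Mapping.lookup p i
    | Y \<Rightarrow> Poly_Mapping.lookup p i - Poly_Mapping.lookup p (Suc i))"

definition coordinate_space :: "nat \<Rightarrow> (nat \<Rightarrow>\<^sub>0 real) set" where
  "coordinate_space n = {p. Poly_Mapping.keys p \<subseteq> {..<n}}"

definition bounds :: "letter list \<Rightarrow> bound set" where
  "bounds v = Lower ` {..<Suc (length v)} \<union> Upper ` {..<Suc (length v)} \<union> Step ` {..<length v}"

lemma lookup_scaleR:
  "Poly_Mapping.lookup (r *\<^sub>R p) i = r * Poly_Mapping.lookup p i" for p :: "'a \<Rightarrow>\<^sub>0 real"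
proof -
  have "finite {i. r * Poly_Mapping.lookup p i \<noteq> 0}"
    by (rule finite_subset[OF _ finite_keys[of p]]) (auto simp: in_keys_iff)
  then show ?thesis
    by (simp add: scaleR_poly_mapping_def)
qed

lemma linear_lookup: "linear (\<lambda>p::'a \<Rightarrow>\<^sub>0 real. Poly_Mapping.lookup p i)"
  by (rule linearI) (simp_all add: lookup_add lookup_scaleR)

lemma coordinate_space_iff:
  "p \<in> coordinate_space n \<longleftrightarrow> (\<forall>i\<ge>n. Poly_Mapping.lookup p i = 0)"
  by (force simp: coordinate_space_def in_keys_iff not_less[symmetric])

interpretation dp: inequality_system "coordinate_space (Suc (length v))" "bounds v"
    bound_const "bound_linear v" for v
proof (rule inequality_system.intro)
  show "subspace (coordinate_space (Suc (length v)))"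
    by (auto simp: subspace_def coordinate_space_iff lookup_add lookup_scaleR)
  show "finite (bounds v)" by (simp add: bounds_def)
  show "linear (bound_linear v c)" for c
    by (rule linearI; cases c)
      (auto simp: lookup_add lookup_scaleR algebra_simps split: letter.split)
qed

lemma descent_polytope_eq_feasible: "descent_polytope v = dp.feasible v"
  unfolding descent_polytope_def dp.feasible_def
  by (auto simp: bounds_def coordinate_space_def ball_Un split: letter.splits)

section \<open>Encoding faces by words\<close>

datatype cell = Bottom | Top | Same | New

definition next_cell :: "real \<Rightarrow> real \<Rightarrow> cell" where
  "next_cell u z = (if z = 0 then Bottom else if z = 1 then Top else if z = u then Same else New)"

text \<open>The first coordinate has no predecessor. The value 0 in place of one ensures that it is
  never marked \<open>Same\<close>.\<close>
definition cell_at :: "(nat \<Rightarrow>\<^sub>0 real) \<Rightarrow> nat \<Rightarrow> cell" where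
  "cell_at p i = next_cell (case i of 0 \<Rightarrow> 0 | Suc k \<Rightarrow> Poly_Mapping.lookup p k)
     (Poly_Mapping.lookup p i)"

definition code :: "letter list \<Rightarrow> (nat \<Rightarrow>\<^sub>0 real) \<Rightarrow> cell list" where
  "code v p = map (cell_at p) [0..<Suc (length v)]"

lemma next_cell_eq_iff:
  "next_cell u z = Bottom \<longleftrightarrow> z = 0"
  "next_cell u z = Top \<longleftrightarrow> z = 1"
  "next_cell u z = Same \<longleftrightarrow> z \<noteq> 0 \<and> z \<noteq> 1 \<and> z = u"
  "next_cell u z = New \<longleftrightarrow> z \<noteq> 0 \<and> z \<noteq> 1 \<and> z \<noteq> u"
  by (auto simp: next_cell_def)

lemma cell_at_0_neq_Same: "cell_at p 0 \<noteq> Same"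
  by (auto simp: cell_at_def next_cell_eq_iff)

lemma cell_at_Suc_eq_Same:
  "cell_at p (Suc i) = Same \<longleftrightarrow> Poly_Mapping.lookup p (Suc i) \<noteq> 0 \<and>
     Poly_Mapping.lookup p (Suc i) \<noteq> 1 \<and> Poly_Mapping.lookup p (Suc i) = Poly_Mapping.lookup p i"
  by (simp add: cell_at_def next_cell_eq_iff)

lemma cell_at_eq_Bottom: "cell_at p i = Bottom \<longleftrightarrow> Poly_Mapping.lookup p i = 0"
  and cell_at_eq_Top: "cell_at p i = Top \<longleftrightarrow> Poly_Mapping.lookup p i = 1"
  by (simp_all add: cell_at_def next_cell_eq_iff)

lemma cell_at_New_interior:
  "cell_at p i = New \<Longrightarrow> Poly_Mapping.lookup p i \<noteq> 0 \<and> Poly_Mapping.lookup p i \<noteq> 1"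
  by (simp add: cell_at_def next_cell_eq_iff)

lemma code_eq_iff: "code v p = code v q \<longleftrightarrow> (\<forall>i\<le>length v. cell_at p i = cell_at q i)"
  by (auto simp: code_def map_eq_conv simp del: upt_Suc)

lemma tight_iff:
  "Lower i \<in> dp.tight v p \<longleftrightarrow> i \<le> length v \<and> Poly_Mapping.lookup p i = 0"
  "Upper i \<in> dp.tight v p \<longleftrightarrow> i \<le> length v \<and> Poly_Mapping.lookup p i = 1"
  "Step i \<in> dp.tight v p \<longleftrightarrow> i < length v \<and> Poly_Mapping.lookup p (Suc i) = Poly_Mapping.lookup p i"
  unfolding dp.tight_def by (auto simp: bounds_def split: letter.split)

text \<open>Equality of neighbouring coordinates is recorded by \<open>Same\<close> for interior values, and is
  visible from the two symbols when a value is 0 or 1.\<close>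
lemma tight_eq_iff_code_eq: "dp.tight v p = dp.tight v q \<longleftrightarrow> code v p = code v q"
proof
  assume eq: "dp.tight v p = dp.tight v q"
  have "cell_at p i = cell_at q i" if "i \<le> length v" for i
  proof (cases i)
    case 0
    then show ?thesis
      using that eq tight_iff(1,2)[of i v p] tight_iff(1,2)[of i v q]
      by (auto simp: cell_at_def next_cell_def)
  next
    case (Suc k)
    then show ?thesis
      using that eq tight_iff(1,2)[of i v p] tight_iff(1,2)[of i v q]
        tight_iff(3)[of k v p] tight_iff(3)[of k v q]
      by (auto simp: cell_at_def next_cell_def)
  qed
  then show "code v p = code v q" by (simp add: code_eq_iff)
next
  assume "code v p = code v q"
  then have eq: "cell_at p i = cell_at q i" if "i \<le> length v" for i
    using that by (simp add: code_eq_iff)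
  have step: "Poly_Mapping.lookup p (Suc i) = Poly_Mapping.lookup p i \<longleftrightarrow>
      (cell_at p (Suc i) = Same \<or> cell_at p (Suc i) = Bottom \<and> cell_at p i = Bottom \<or>
       cell_at p (Suc i) = Top \<and> cell_at p i = Top)" for p i
    by (auto simp: cell_at_Suc_eq_Same cell_at_eq_Bottom cell_at_eq_Top)
  have "c \<in> dp.tight v p \<longleftrightarrow> c \<in> dp.tight v q" for c
    by (cases c) (auto simp: tight_iff step eq simp flip: cell_at_eq_Bottom cell_at_eq_Top)
  then show "dp.tight v p = dp.tight v q" by blast
qed

text \<open>The first index of the maximal block of equal interior coordinates that contains the given
  one; an index of a coordinate 0 or 1 is its own block.\<close>
fun block_start :: "(nat \<Rightarrow>\<^sub>0 real) \<Rightarrow> nat \<Rightarrow> nat" where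
  "block_start p 0 = 0"
| "block_start p (Suc i) = (if cell_at p (Suc i) = Same then block_start p i else Suc i)"

lemma block_start_le: "block_start p i \<le> i"
  by (induction i) auto

lemma cell_at_block_start: "cell_at p (block_start p i) \<noteq> Same"
  by (induction i) (auto simp: cell_at_0_neq_Same)

lemma block_start_New: "cell_at p i = New \<Longrightarrow> block_start p i = i"
  by (cases i) auto

lemma lookup_block_start: "Poly_Mapping.lookup p (block_start p i) = Poly_Mapping.lookup p i"
  by (induction i) (auto simp: cell_at_Suc_eq_Same)

text \<open>The indicator vectors of the blocks of equal interior coordinates form a basis of the
  direction space: a direction is constant on each such block and vanishes where the point has a
  coordinate 0 or 1. Evaluation at the first indices of the blocks is the dual family.\<close>
lemma affine_dimension_tight_face:
  assumes p: "p \<in> descent_polytope v"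
  shows "affine_dimension (dp.tight_face v p) = count_list (code v p) New"
proof -
  let ?n = "Suc (length v)"
  let ?D = "{x - y |x y. x \<in> dp.tight_face v p \<and> y \<in> dp.tight_face v p}"
  define J where "J = {i. i < ?n \<and> cell_at p i = New}"
  define f where "f i = (\<Sum>j | j < ?n \<and> block_start p j = i. Poly_Mapping.single j (1::real))" for i
  have pf: "p \<in> dp.feasible v" using p by (simp add: descent_polytope_eq_feasible)
  have lookup_f: "Poly_Mapping.lookup (f i) j = (if j < ?n \<and> block_start p j = i then 1 else 0)" for i j
    by (simp add: f_def lookup_sum lookup_single when_def)
  have "dim ?D = card J"
  proof (rule dim_eq_card_dual_family[where \<phi> = "\<lambda>i d. Poly_Mapping.lookup d i" and f = f])
    show "finite J" by (simp add: J_def)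
    show "linear (\<lambda>d :: nat \<Rightarrow>\<^sub>0 real. Poly_Mapping.lookup d i)" for i by (rule linear_lookup)
    show "Poly_Mapping.lookup (f j) i = (if i = j then 1 else 0)" if "i \<in> J" "j \<in> J" for i j
      using that by (auto simp: lookup_f J_def block_start_New)
    show "f ` J \<subseteq> span ?D"
    proof (rule image_subsetI)
      fix i assume i: "i \<in> J"
      show "f i \<in> span ?D"
      proof (rule dp.span_directions_tight_face[OF pf])
        show "f i \<in> coordinate_space ?n" by (simp add: coordinate_space_iff lookup_f)
        have interior: "Poly_Mapping.lookup p j \<noteq> 0 \<and> Poly_Mapping.lookup p j \<noteq> 1"
          if "block_start p j = i" for j
          using i lookup_block_start[of p j] cell_at_New_interior[of p i]
          by (simp add: J_def that)
        show "bound_linear v c (f i) = 0" if c: "c \<in> dp.tight v p" for c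
        proof (cases c)
          case (Lower j)
          then show ?thesis using c interior[of j] by (auto simp: tight_iff lookup_f)
        next
          case (Upper j)
          then show ?thesis using c interior[of j] by (auto simp: tight_iff lookup_f)
        next
          case (Step j)
          then have "Poly_Mapping.lookup (f i) (Suc j) = Poly_Mapping.lookup (f i) j"
            using c interior[of j] interior[of "Suc j"]
            by (auto simp: tight_iff lookup_f cell_at_Suc_eq_Same simp del: block_start.simps(2))
              (auto simp: cell_at_Suc_eq_Same split: if_splits)
          then show ?thesis using Step by (simp split: letter.split)
        qed
      qed
    qed
    fix d assume "d \<in> ?D"
    note d = dp.direction_tight_face[OF pf this]
    have d0: "Poly_Mapping.lookup d i = 0" if "i < ?n" "cell_at p i = Bottom \<or> cell_at p i = Top" for i
      using d(2)[of "Lower i"] d(2)[of "Upper i"] that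
      by (auto simp: tight_iff cell_at_eq_Bottom cell_at_eq_Top)
    have block: "Poly_Mapping.lookup d (block_start p i) = Poly_Mapping.lookup d i" if "i < ?n" for i
      using that
    proof (induction i)
      case (Suc i)
      have "Poly_Mapping.lookup d (Suc i) = Poly_Mapping.lookup d i" if "cell_at p (Suc i) = Same"
        using d(2)[of "Step i"] that Suc.prems
        by (auto simp: tight_iff cell_at_Suc_eq_Same split: letter.splits)
      then show ?case using Suc by auto
    qed simp
    show "d = (\<Sum>j\<in>J. Poly_Mapping.lookup d j *\<^sub>R f j)"
    proof (rule poly_mapping_eqI)
      fix i
      have sum: "Poly_Mapping.lookup (\<Sum>j\<in>J. Poly_Mapping.lookup d j *\<^sub>R f j) i =
          (\<Sum>j\<in>J. if i < ?n \<and> block_start p i = j then Poly_Mapping.lookup d j else 0)"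
        by (simp add: lookup_sum lookup_scaleR lookup_f if_distrib cong: if_cong)
      show "Poly_Mapping.lookup d i = Poly_Mapping.lookup (\<Sum>j\<in>J. Poly_Mapping.lookup d j *\<^sub>R f j) i"
      proof (cases "i < ?n")
        case True
        let ?s = "block_start p i"
        have s: "?s < ?n" using True block_start_le[of p i] by linarith
        have "Poly_Mapping.lookup d i = (if ?s \<in> J then Poly_Mapping.lookup d ?s else 0)"
        proof (cases "?s \<in> J")
          case True
          then show ?thesis using block[OF \<open>i < ?n\<close>] by simp
        next
          case False
          then have "cell_at p ?s = Bottom \<or> cell_at p ?s = Top"
            using cell_at_block_start[of p i] s by (cases "cell_at p ?s") (auto simp: J_def)
          then show ?thesis using d0[OF s] block[OF True] False by simp
        qed
        moreover have "finite J" by (simp add: J_def)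
        ultimately show ?thesis using True by (simp add: sum)
      next
        case False
        then show ?thesis using d(1) by (simp add: sum coordinate_space_iff)
      qed
    qed
  qed
  also have "card J = count_list (code v p) New"
  proof -
    have "count_list (code v p) New = length (filter (\<lambda>i. cell_at p i = New) [0..<?n])"
      by (simp add: code_def count_list_eq_length_filter filter_map comp_def eq_commute del: upt_Suc)
    also have "\<dots> = card (set (filter (\<lambda>i. cell_at p i = New) [0..<?n]))"
      by (intro distinct_card[symmetric] distinct_filter distinct_upt)
    also have "set (filter (\<lambda>i. cell_at p i = New) [0..<?n]) = J"
      by (auto simp: J_def simp del: upt_Suc)
    finally show ?thesis by simp
  qed
  finally show ?thesis by (simp add: affine_dimension_def)
qed

definition codes :: "letter list \<Rightarrow> cell list set" where
  "codes v = code v ` descent_polytope v"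

text \<open>With \<open>h = 1\<close> this is the \<open>f\<close>-polynomial. Other functions \<open>h\<close> of the last symbol are needed
  because the possible continuations depend on it.\<close>
definition code_sum :: "(cell \<Rightarrow> int poly) \<Rightarrow> letter list \<Rightarrow> int poly" where
  "code_sum h v = (\<Sum>c\<in>codes v. monom 1 (count_list c New) * h (last c))"

text \<open>Two maps that identify the same elements of \<open>P\<close> have images in canonical bijection.\<close>
lemma sum_image_eq_sum_image:
  assumes ker: "\<And>p q. p \<in> P \<Longrightarrow> q \<in> P \<Longrightarrow> f p = f q \<longleftrightarrow> g p = g q"
    and val: "\<And>p. p \<in> P \<Longrightarrow> a (f p) = b (g p)"
  shows "sum a (f ` P) = sum b (g ` P)"
proof -
  define k where "k y = g (SOME p. p \<in> P \<and> f p = y)" for y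
  have k: "k (f p) = g p" if "p \<in> P" for p
    unfolding k_def using someI[of "\<lambda>q. q \<in> P \<and> f q = f p" p] that ker by blast
  show ?thesis
  proof (rule sum.reindex_cong[of k, symmetric])
    show "inj_on k (f ` P)"
      by (rule inj_onI) (use k ker in auto)
    show "g ` P = k ` f ` P" using k by (simp add: image_image)
    show "b (k y) = a y" if "y \<in> f ` P" for y using that k val by auto
  qed
qed

lemma f_polynomial_eq_code_sum: "f_polynomial v = code_sum (\<lambda>_. 1) v"
proof -
  have "f_polynomial v =
      (\<Sum>F\<in>dp.tight_face v ` descent_polytope v. monom 1 (affine_dimension F))"
    unfolding f_polynomial_def descent_polytope_eq_feasible dp.nonempty_faces ..
  also have "\<dots> = (\<Sum>c\<in>code v ` descent_polytope v. monom 1 (count_list c New))"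
    by (rule sum_image_eq_sum_image)
      (simp_all add: affine_dimension_tight_face descent_polytope_eq_feasible
        dp.tight_face_eq_iff tight_eq_iff_code_eq)
  finally show ?thesis by (simp add: code_sum_def codes_def)
qed

section \<open>The transfer recursion\<close>

fun step_ok :: "letter \<Rightarrow> real \<Rightarrow> real \<Rightarrow> bool" where
  "step_ok X u z \<longleftrightarrow> u \<le> z"
| "step_ok Y u z \<longleftrightarrow> z \<le> u"

text \<open>The possible symbols of the next coordinate, given the letter and the symbol of the last
  coordinate. An interior value constrains the next one in the same way whether it is \<open>Same\<close> or
  \<open>New\<close>.\<close>
fun successors :: "letter \<Rightarrow> cell \<Rightarrow> cell set" where
  "successors X Bottom = {Bottom, New, Top}"
| "successors X Top = {Top}"
| "successors X _ = {Same, New, Top}"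
| "successors Y Bottom = {Bottom}"
| "successors Y Top = {Top, New, Bottom}"
| "successors Y _ = {Same, New, Bottom}"

text \<open>The last coordinate has value \<open>u\<close> and predecessor \<open>w\<close>. The symbol \<open>New\<close> is realised by the
  midpoint of \<open>u\<close> and the end of the unit interval towards which the letter points.\<close>
lemma next_cells:
  assumes "0 \<le> u" "u \<le> 1"
  shows "next_cell u ` {z. 0 \<le> z \<and> z \<le> 1 \<and> step_ok a u z} = successors a (next_cell w u)"
proof -
  let ?Z = "{z. 0 \<le> z \<and> z \<le> 1 \<and> step_ok a u z}"
  have A: "z \<in> ?Z \<Longrightarrow> next_cell u z \<in> successors a (next_cell w u)" for z
    using assms by (cases a) (auto simp: next_cell_def)
  have B: "s \<in> next_cell u ` ?Z" if "z \<in> ?Z" "next_cell u z = s" for z s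
    using that by blast
  have "successors a (next_cell w u) \<subseteq> next_cell u ` ?Z"
  proof
    fix s assume s: "s \<in> successors a (next_cell w u)"
    show "s \<in> next_cell u ` ?Z"
    proof (cases s)
      case Bottom
      show ?thesis by (rule B[of 0]) (use Bottom s assms in \<open>cases a; auto simp: next_cell_def split: if_splits\<close>)+
    next
      case Top
      show ?thesis by (rule B[of 1]) (use Top s assms in \<open>cases a; auto simp: next_cell_def split: if_splits\<close>)+
    next
      case Same
      show ?thesis by (rule B[of u]) (use Same s assms in \<open>cases a; auto simp: next_cell_def split: if_splits\<close>)+
    next
      case New
      show ?thesis
        by (rule B[of "if a = X then (u + 1) / 2 else u / 2"])
          (use New s assms in \<open>cases a; auto simp: next_cell_def split: if_splits\<close>)+
    qed
  qed
  then show ?thesis using A by blast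
qed

lemma descent_polytope_Nil:
  "descent_polytope [] = Poly_Mapping.single 0 ` {0..1}"
proof (intro equalityI subsetI)
  fix p assume p: "p \<in> descent_polytope []"
  have "p = Poly_Mapping.single 0 (Poly_Mapping.lookup p 0)"
    by (rule poly_mapping_eqI)
      (use p in \<open>auto simp: descent_polytope_def lookup_single when_def in_keys_iff subset_iff\<close>)
  then show "p \<in> Poly_Mapping.single 0 ` {0..1}"
    using p by (intro image_eqI[of _ _ "Poly_Mapping.lookup p 0"]) (auto simp: descent_polytope_def)
qed (auto simp: descent_polytope_def split: if_splits)

lemma descent_polytope_snoc:
  "descent_polytope (v @ [a]) =
     {q + Poly_Mapping.single (Suc (length v)) z | q z. q \<in> descent_polytope v \<and>
        0 \<le> z \<and> z \<le> 1 \<and> step_ok a (Poly_Mapping.lookup q (length v)) z}" (is "_ = ?R")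
proof -
  let ?n = "Suc (length v)"
  have mem: "p \<in> descent_polytope w \<longleftrightarrow> (\<forall>i\<ge>Suc (length w). Poly_Mapping.lookup p i = 0) \<and>
      (\<forall>i<Suc (length w). 0 \<le> Poly_Mapping.lookup p i \<and> Poly_Mapping.lookup p i \<le> 1) \<and>
      (\<forall>i<length w. step_ok (w ! i) (Poly_Mapping.lookup p i) (Poly_Mapping.lookup p (Suc i)))"
    for p w
  proof -
    have keys: "Poly_Mapping.keys p \<subseteq> {..<n} \<longleftrightarrow> (\<forall>i\<ge>n. Poly_Mapping.lookup p i = 0)" for n
      using coordinate_space_iff[of p n] by (simp only: coordinate_space_def mem_Collect_eq)
    have "(case a of X \<Rightarrow> u \<le> z | Y \<Rightarrow> u \<ge> z) \<longleftrightarrow> step_ok a u z" for a and u z :: real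
      by (cases a) simp_all
    then show ?thesis by (simp only: descent_polytope_def mem_Collect_eq keys)
  qed
  show ?thesis
  proof (intro equalityI subsetI)
    fix p assume p: "p \<in> descent_polytope (v @ [a])"
    define z where "z = Poly_Mapping.lookup p ?n"
    define q where "q = p - Poly_Mapping.single ?n z"
    have q: "Poly_Mapping.lookup q i = (if i = ?n then 0 else Poly_Mapping.lookup p i)" for i
      by (simp add: q_def lookup_minus lookup_single when_def z_def)
    have bits: "\<forall>i\<ge>Suc ?n. Poly_Mapping.lookup p i = 0"
        "\<forall>i<Suc ?n. 0 \<le> Poly_Mapping.lookup p i \<and> Poly_Mapping.lookup p i \<le> 1"
        "\<forall>i<?n. step_ok ((v @ [a]) ! i) (Poly_Mapping.lookup p i) (Poly_Mapping.lookup p (Suc i))"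
      using p unfolding mem by simp_all
    have "step_ok (v ! i) (Poly_Mapping.lookup p i) (Poly_Mapping.lookup p (Suc i))"
      if "i < length v" for i
      using bits(3)[rule_format, of i] that by (simp add: nth_append)
    moreover have "Poly_Mapping.lookup q i = 0" if "i \<ge> ?n" for i
      using that bits(1) by (simp add: q)
    ultimately have "q \<in> descent_polytope v"
      unfolding mem using bits(2) by (simp add: q)
    moreover have "step_ok a (Poly_Mapping.lookup q (length v)) z"
      using bits(3)[rule_format, of "length v"] by (simp add: q z_def)
    moreover have "p = q + Poly_Mapping.single ?n z" by (simp add: q_def)
    moreover have "0 \<le> z" "z \<le> 1" using bits(2) by (simp_all add: z_def)
    ultimately show "p \<in> ?R" by blast
  next
    fix p assume "p \<in> ?R"
    then obtain q z where p: "p = q + Poly_Mapping.single ?n z" and q: "q \<in> descent_polytope v"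
      and z: "0 \<le> z" "z \<le> 1" "step_ok a (Poly_Mapping.lookup q (length v)) z" by blast
    have "Poly_Mapping.lookup q ?n = 0" using q by (simp add: mem)
    then have "Poly_Mapping.lookup p i = (if i = ?n then z else Poly_Mapping.lookup q i)" for i
      by (simp add: p lookup_add lookup_single when_def)
    then show "p \<in> descent_polytope (v @ [a])"
      using q z unfolding mem by (auto simp: nth_append less_Suc_eq)
  qed
qed

lemma codes_Nil: "codes [] = {[Bottom], [Top], [New]}"
proof -
  have "codes [] = (\<lambda>z. [next_cell 0 z]) ` {0..1}"
    by (simp add: codes_def descent_polytope_Nil image_image code_def cell_at_def)
  also have "\<dots> = (\<lambda>s. [s]) ` next_cell 0 ` {z. 0 \<le> z \<and> z \<le> 1 \<and> step_ok X 0 z}"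
    by (auto simp: image_image)
  also have "\<dots> = (\<lambda>s. [s]) ` successors X (next_cell 0 0)"
    by (subst next_cells) auto
  finally show ?thesis by (auto simp: next_cell_def)
qed

text \<open>Every point of the smaller polytope with a given code admits the same symbols for an added
  coordinate, so the set of codes is generated like a regular language.\<close>
lemma codes_snoc:
  "codes (v @ [a]) = (\<lambda>(c, s). c @ [s]) ` (SIGMA c:codes v. successors a (last c))"
proof -
  let ?n = "Suc (length v)"
  have code_add: "code (v @ [a]) (q + Poly_Mapping.single ?n z) =
      code v q @ [next_cell (Poly_Mapping.lookup q (length v)) z]" if q: "q \<in> descent_polytope v" for q z
  proof -
    have "Poly_Mapping.lookup q ?n = 0"
      using q by (auto simp: descent_polytope_def in_keys_iff)
    then show ?thesis
      by (auto simp: code_def cell_at_def lookup_add lookup_single when_def split: nat.split)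
  qed
  have last: "last (code v q) = next_cell (case length v of 0 \<Rightarrow> 0 | Suc k \<Rightarrow> Poly_Mapping.lookup q k)
      (Poly_Mapping.lookup q (length v))" for q
    by (simp add: code_def cell_at_def)
  have succ: "successors a (last (code v q)) = next_cell (Poly_Mapping.lookup q (length v)) `
      {z. 0 \<le> z \<and> z \<le> 1 \<and> step_ok a (Poly_Mapping.lookup q (length v)) z}"
    if "q \<in> descent_polytope v" for q
    unfolding last by (rule next_cells[symmetric]) (use that in \<open>auto simp: descent_polytope_def\<close>)
  show ?thesis (is "_ = ?R")
  proof (intro equalityI subsetI)
    fix c assume "c \<in> codes (v @ [a])"
    then obtain q z where q: "q \<in> descent_polytope v"
      and z: "0 \<le> z" "z \<le> 1" "step_ok a (Poly_Mapping.lookup q (length v)) z"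
      and c: "c = code (v @ [a]) (q + Poly_Mapping.single ?n z)"
      by (auto simp: codes_def descent_polytope_snoc)
    have "next_cell (Poly_Mapping.lookup q (length v)) z \<in> successors a (last (code v q))"
      unfolding succ[OF q] using z by blast
    then show "c \<in> ?R" using q by (force simp: c code_add codes_def)
  next
    fix c assume "c \<in> ?R"
    then obtain q s where q: "q \<in> descent_polytope v" and s: "s \<in> successors a (last (code v q))"
      and c: "c = code v q @ [s]" by (auto simp: codes_def)
    obtain z where z: "0 \<le> z" "z \<le> 1" "step_ok a (Poly_Mapping.lookup q (length v)) z"
      and s: "s = next_cell (Poly_Mapping.lookup q (length v)) z"
      using s unfolding succ[OF q] by blast
    have "q + Poly_Mapping.single ?n z \<in> descent_polytope (v @ [a])"
      unfolding descent_polytope_snoc using q z by blast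
    then show "c \<in> codes (v @ [a])"
      unfolding codes_def by (rule rev_image_eqI) (simp add: c s code_add[OF q])
  qed
qed

lemma finite_codes: "finite (codes v)"
proof -
  have "finite (UNIV :: cell set)"
    by (rule finite_subset[of _ "{Bottom, Top, Same, New}"]) (auto intro: cell.exhaust)
  then have "finite {c :: cell list. set c \<subseteq> UNIV \<and> length c = Suc (length v)}"
    by (rule finite_lists_length_eq)
  then show ?thesis by (rule rev_finite_subset) (auto simp: codes_def code_def)
qed

definition cell_weight :: "cell \<Rightarrow> int poly" where
  "cell_weight s = (if s = New then monom 1 1 else 1)"

lemma code_sum_Nil: "code_sum h [] = h Bottom + h Top + monom 1 1 * h New"
  by (simp add: code_sum_def codes_Nil add.assoc)

lemma code_sum_snoc:
  "code_sum h (v @ [a]) = code_sum (\<lambda>s. \<Sum>s'\<in>successors a s. cell_weight s' * h s') v"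
proof -
  have fin: "finite (successors a s)" for s by (cases "(a, s)" rule: successors.cases) auto
  have inj: "inj_on (\<lambda>(c, s). c @ [s]) A" for A :: "(cell list \<times> cell) set"
    by (auto simp: inj_on_def)
  have w: "monom 1 (count_list (c @ [s]) New) = monom 1 (count_list c New) * cell_weight s" for c s
    by (simp add: cell_weight_def mult_monom)
  have "code_sum h (v @ [a]) = (\<Sum>(c, s)\<in>(SIGMA c:codes v. successors a (last c)).
      monom 1 (count_list (c @ [s]) New) * h s)"
    unfolding code_sum_def codes_snoc sum.reindex[OF inj] by (intro sum.cong) auto
  also have "\<dots> = (\<Sum>c\<in>codes v. \<Sum>s\<in>successors a (last c). monom 1 (count_list (c @ [s]) New) * h s)"
    by (rule sum.Sigma[symmetric]) (use finite_codes fin in auto)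
  also have "\<dots> = code_sum (\<lambda>s. \<Sum>s'\<in>successors a s. cell_weight s' * h s') v"
    unfolding code_sum_def w by (simp add: sum_distrib_left mult.assoc)
  finally show ?thesis .
qed

lemma code_sum_add: "code_sum (\<lambda>s. g s + h s) v = code_sum g v + code_sum h v"
  and code_sum_scale: "code_sum (\<lambda>s. k * h s) v = k * code_sum h v"
  by (simp_all add: code_sum_def sum.distrib algebra_simps sum_distrib_left)

text \<open>The indicator functions of the three kinds of symbols span a space that is invariant under
  the transfer operator; in the basis consisting of 1 and the next two functions the operator takes a
  simple form.\<close>
abbreviation not_top :: "cell \<Rightarrow> int poly" where
  "not_top s \<equiv> of_bool (s \<noteq> Top)"

abbreviation not_bottom :: "cell \<Rightarrow> int poly" where
  "not_bottom s \<equiv> of_bool (s \<noteq> Bottom)"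

abbreviation t1 :: "int poly" where
  "t1 \<equiv> monom 1 1 + 1"

lemma code_sum_snoc_eq:
  assumes "\<And>s. (\<Sum>s'\<in>successors a s. cell_weight s' * h s') = h0 s + t1 * h1 s"
  shows "code_sum h (v @ [a]) = code_sum h0 v + t1 * code_sum h1 v"
  by (simp add: code_sum_snoc assms code_sum_add code_sum_scale)

text \<open>Every case is a check of the transfer operator on the four symbols. For instance, for the
  letter \<open>X\<close> a symbol other than \<open>Top\<close> has three successors of total weight \<open>t + 2\<close>, while \<open>Top\<close>
  has only itself; the difference from 1 is \<open>t + 1\<close> times the indicator function of not being
  \<open>Top\<close>.\<close>
lemma code_sum_recursion:
  "code_sum (\<lambda>_. 1) (v @ [X]) = code_sum (\<lambda>_. 1) v + t1 * code_sum not_top v"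
  "code_sum (\<lambda>_. 1) (v @ [Y]) = code_sum (\<lambda>_. 1) v + t1 * code_sum not_bottom v"
  "code_sum not_top (v @ [Y]) = code_sum not_top v + t1 * code_sum not_bottom v"
  "code_sum not_bottom (v @ [X]) = code_sum not_bottom v + t1 * code_sum not_top v"
  "code_sum not_top (v @ [X]) = t1 * code_sum not_top v"
  "code_sum not_bottom (v @ [Y]) = t1 * code_sum not_bottom v"
proof -
  have zero: "code_sum (\<lambda>_. 0) v = 0" by (simp add: code_sum_def)
  show "code_sum (\<lambda>_. 1) (v @ [X]) = code_sum (\<lambda>_. 1) v + t1 * code_sum not_top v"
    by (rule code_sum_snoc_eq) (case_tac s; simp add: cell_weight_def)
  show "code_sum (\<lambda>_. 1) (v @ [Y]) = code_sum (\<lambda>_. 1) v + t1 * code_sum not_bottom v"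
    by (rule code_sum_snoc_eq) (case_tac s; simp add: cell_weight_def)
  show "code_sum not_top (v @ [Y]) = code_sum not_top v + t1 * code_sum not_bottom v"
    by (rule code_sum_snoc_eq) (case_tac s; simp add: cell_weight_def)
  show "code_sum not_bottom (v @ [X]) = code_sum not_bottom v + t1 * code_sum not_top v"
    by (rule code_sum_snoc_eq) (case_tac s; simp add: cell_weight_def)
  show "code_sum not_top (v @ [X]) = t1 * code_sum not_top v"
  proof -
    have "code_sum not_top (v @ [X]) = code_sum (\<lambda>_. 0) v + t1 * code_sum not_top v"
      by (rule code_sum_snoc_eq) (case_tac s; simp add: cell_weight_def)
    then show ?thesis by (simp add: zero)
  qed
  show "code_sum not_bottom (v @ [Y]) = t1 * code_sum not_bottom v"
  proof -
    have "code_sum not_bottom (v @ [Y]) = code_sum (\<lambda>_. 0) v + t1 * code_sum not_bottom v"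
      by (rule code_sum_snoc_eq) (case_tac s; simp add: cell_weight_def)
    then show ?thesis by (simp add: zero)
  qed
qed

section \<open>Solving the system of equations of power series\<close>

lemma coeff_word_nc_const: "coeff_word (nc_const c) w = (if w = [] then c else 0)"
  by (simp add: nc_const_def Abs_ncfps_inverse)

lemma coeff_word_nc_var: "coeff_word (nc_var a) w = (if w = [a] then 1 else 0)"
  by (simp add: nc_var_def Abs_ncfps_inverse)

lemma coeff_word_const_mult: "coeff_word (nc_const c * f) w = c * coeff_word f w"
proof -
  have "(\<Sum>i=0..length w. coeff_word (nc_const c) (take i w) * coeff_word f (drop i w))
      = (\<Sum>i=0..length w. if i = 0 then c * coeff_word f w else 0)"
    by (rule sum.cong) (auto simp: coeff_word_nc_const)
  then show ?thesis by (simp add: times_ncfps.rep_eq)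
qed

lemma coeff_word_mult_const: "coeff_word (f * nc_const c) w = coeff_word f w * c"
proof -
  have "(\<Sum>i=0..length w. coeff_word f (take i w) * coeff_word (nc_const c) (drop i w))
      = (\<Sum>i=0..length w. if i = length w then coeff_word f w * c else 0)"
    by (rule sum.cong) (auto simp: coeff_word_nc_const)
  then show ?thesis by (simp add: times_ncfps.rep_eq)
qed

text \<open>This expresses that \<open>t\<close> commutes with the variables.\<close>
lemma nc_const_commute: "f * nc_const c = nc_const c * f" for c :: "'r::comm_ring_1"
  by (rule ncfps_eqI) (simp add: coeff_word_const_mult coeff_word_mult_const mult.commute)

lemma coeff_word_mult_var_Nil: "coeff_word (f * nc_var a) [] = 0"
  by (simp add: times_ncfps.rep_eq coeff_word_nc_var)

lemma coeff_word_mult_var_snoc: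
  "coeff_word (f * nc_var a) (w @ [c]) = (if c = a then coeff_word f w else 0)"
proof -
  have "coeff_word f (take i (w @ [c])) * coeff_word (nc_var a) (drop i (w @ [c]))
      = (if i = length w then (if c = a then coeff_word f w else 0) else 0)" if "i \<le> Suc (length w)" for i
  proof -
    have "i = length w" if "drop i (w @ [c]) = [a]"
      using arg_cong[OF that, of length] \<open>i \<le> Suc (length w)\<close> by simp
    then show ?thesis by (auto simp: coeff_word_nc_var)
  qed
  then have "coeff_word (f * nc_var a) (w @ [c])
      = (\<Sum>i=0..Suc (length w). if i = length w then (if c = a then coeff_word f w else 0) else 0)"
    unfolding times_ncfps.rep_eq by (intro sum.cong) auto
  then show ?thesis by simp
qed

lemma ncfps_eqI_snoc:
  assumes "coeff_word f [] = coeff_word g []"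
    and "\<And>w a. coeff_word f (w @ [a]) = coeff_word g (w @ [a])"
  shows "f = g"
  by (rule ncfps_eqI) (metis assms rev_exhaust)

text \<open>The geometric series is known to be the value of \<open>inverse\<close> at \<open>1 - g\<close>. Its constant term is
  1, so that value is not the default 0 and must be a true inverse.\<close>
lemma inverse_one_minus:
  fixes g :: "('a, 'r::ring_1) ncfps"
  assumes "coeff_word g [] = 0"
  shows "(1 - g) * inverse (1 - g) = 1"
proof -
  have "\<exists>h. (1 - g) * h = 1 \<and> h * (1 - g) = 1"
  proof (rule ccontr)
    assume "\<not> ?thesis"
    then have "inverse (1 - g) = 0" unfolding inverse_ncfps_def by (rule if_not_P)
    then have "nc_geometric g = 0" by (simp add: inverse_one_minus_eq_geometric[OF assms])
    then have "coeff_word (nc_geometric g) [] = 0" by (simp add: zero_ncfps.rep_eq)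
    then show False using coeff_word_geometric[OF assms, of "[]" 0] by (simp add: one_ncfps.rep_eq)
  qed
  then show ?thesis using inverse_ncfps_eqI by metis
qed

lemma eq_mult_inverse:
  fixes f g h :: "('a, 'r::ring_1) ncfps"
  assumes "coeff_word g [] = 0" and "f = h + f * g"
  shows "f = h * inverse (1 - g)"
proof -
  have "f * (1 - g) = h" using assms(2) by (simp add: right_diff_distrib diff_eq_eq)
  then have "h * inverse (1 - g) = f * ((1 - g) * inverse (1 - g))"
    by (metis mult.assoc)
  then show ?thesis by (simp add: inverse_one_minus[OF assms(1)])
qed

theorem theorem3p2:
  fixes t x y :: "(letter, int poly) ncfps"
  defines "t \<equiv> nc_const (monom 1 1)"
    and "x \<equiv> nc_var X"
    and "y \<equiv> nc_var Y"
  shows "Phi = (1 + (t + 1) / (1 - (t + 1) * (inverse (1 - y) * x + inverse (1 - x) * y)))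
                 * (1 / (1 - x - y))"
proof -
  \<comment> \<open>The coefficients of \<open>P\<close>, \<open>Q\<close> and \<open>Phi\<close> at a word ending in a letter are given by
    the recursion; this yields the three equations below.\<close>
  define P where "P = Abs_ncfps (code_sum not_top)"
  define Q where "Q = Abs_ncfps (code_sum not_bottom)"
  define B where "B = (t + 1) * (1 + P * x + Q * y)"
  have t: "t + 1 = nc_const t1"
    unfolding t_def
    by (rule ncfps_eqI) (simp add: plus_ncfps.rep_eq one_ncfps.rep_eq coeff_word_nc_const)
  have coeffs: "coeff_word P w = code_sum not_top w" "coeff_word Q w = code_sum not_bottom w"
    "coeff_word Phi w = code_sum (\<lambda>_. 1) w" for w
    by (simp_all add: P_def Q_def Phi_def f_polynomial_eq_code_sum Abs_ncfps_inverse)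
  note simps = plus_ncfps.rep_eq one_ncfps.rep_eq coeff_word_nc_const coeff_word_const_mult distrib_left coeffs
    coeff_word_mult_var_Nil coeff_word_mult_var_snoc
  have P: "P = B + P * y"
    unfolding B_def t x_def y_def
  proof (rule ncfps_eqI_snoc)
    fix w a
    show "coeff_word P (w @ [a]) = coeff_word (nc_const t1 * (1 + P * nc_var X + Q * nc_var Y) + P * nc_var Y) (w @ [a])"
      by (cases a) (simp_all add: simps code_sum_recursion)
  qed (simp add: simps code_sum_Nil)
  have Q: "Q = B + Q * x"
    unfolding B_def t x_def y_def
  proof (rule ncfps_eqI_snoc)
    fix w a
    show "coeff_word Q (w @ [a]) = coeff_word (nc_const t1 * (1 + P * nc_var X + Q * nc_var Y) + Q * nc_var X) (w @ [a])"
      by (cases a) (simp_all add: simps code_sum_recursion)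
  qed (simp add: simps code_sum_Nil)
  have Phi: "Phi = (1 + B) + Phi * (x + y)"
    unfolding B_def t x_def y_def
  proof (rule ncfps_eqI_snoc)
    fix w a
    show "coeff_word Phi (w @ [a]) = coeff_word (1 + nc_const t1 * (1 + P * nc_var X + Q * nc_var Y) + Phi * (nc_var X + nc_var Y)) (w @ [a])"
      by (cases a) (simp_all add: simps code_sum_recursion)
  qed (simp add: simps code_sum_Nil)
  define G where "G = inverse (1 - y) * x + inverse (1 - x) * y"
  have const0: "coeff_word x [] = 0" "coeff_word y [] = 0" "coeff_word G [] = 0"
    by (simp_all add: x_def y_def G_def coeff_word_nc_var plus_ncfps.rep_eq coeff_word_mult_var_Nil)
  have "P = B * inverse (1 - y)" "Q = B * inverse (1 - x)"
    using const0 P Q by (auto intro: eq_mult_inverse)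
  then have "P * x + Q * y = B * G"
    by (simp add: G_def distrib_left mult.assoc)
  then have "B = (t + 1) + B * ((t + 1) * G)"
    using nc_const_commute[of B t1] unfolding B_def[symmetric]
    by (subst B_def) (simp add: t add.assoc distrib_left mult.assoc[symmetric])
  then have "B = (t + 1) / (1 - (t + 1) * G)"
    unfolding divide_ncfps_def
    by (rule eq_mult_inverse[rotated]) (simp add: t coeff_word_const_mult const0)
  moreover have "Phi = (1 + B) * inverse (1 - (x + y))"
    by (rule eq_mult_inverse[OF _ Phi]) (simp add: const0 plus_ncfps.rep_eq)
  ultimately show ?thesis
    by (simp add: G_def divide_ncfps_def diff_diff_eq)
qed

end
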